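(* Let $r$ be an integer with $r>1$ and let $q>0$ be real. Put $y_n(x)=\mathcal{L}_n(x;q,r)$, $n\in\mathbb{Z}_+$, and $\xi=r-1$, and let $$d_k(x)=\left(\frac{(r-1)!}{k!}\right)^2\frac{1}{(r-1-k)!}\,x^k,\qquad k=0,1,\ldots,r-1,$$ $$M(x)=\begin{pmatrix} d_0(x)\\ d_1(x)\\ \vdots\\ d_\xi(x)\end{pmatrix}\bigl(d_0(x),d_1(x),\ldots,d_\xi(x)\bigr),\qquad x\in(0,\infty).$$ Then for all $n,m\in\mathbb{Z}_+$, $$\int_0^\infty \bigl(y_n(x),y_n'(x),\ldots,y_n^{(\xi)}(x)\bigr)\,M(x)\begin{pmatrix} y_m(x)\\ y_m'(x)\\ \vdots\\ y_m^{(\xi)}(x)\end{pmatrix}x^{q-1}e^{-x}\,dx=A_n\delta_{n,m},$$ where $$A_n=\frac{((r-1)!)^2\,\Gamma(q+n)}{\binom{n+q-1}{n}^2\,n!},\qquad n\in\mathbb{Z}_+.$$ Moreover, let $D_\xi$ and $L_2$ be the differential operators $D_\xi y(t)=\sum_{k=0}^{\xi}d_k(t)y^{(k)}(t)$ and $L_2 y(t)=t\,y''(t)+(q-t)\,y'(t)$. Then $$L_2 D_\xi y_n(t)=-n\,D_\xi y_n(t),\qquad n\in\mathbb{Z}_+.$$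
   Context: $\mathbb{Z}_+$ is the set of non-negative integers, and $\delta_{n,m}$ is the Kronecker delta. The shifted factorial is $(c)_0=1$, $(c)_k=c(c+1)\cdots(c+k-1)$ for $k\geq 1$. For $q,r>0$ and $n\in\mathbb{Z}_+$, $$\mathcal{L}_n(x;q,r)={}_2F_2(-n,1;q,r;x)=\sum_{k=0}^{n}\frac{(-n)_k(1)_k}{(q)_k(r)_k}\frac{x^k}{k!}.$$ For real $s>0$, $\binom{n+s-1}{n}=\frac{(s)_n}{n!}=\frac{\Gamma(n+s)}{n!\,\Gamma(s)}$. $L_2D_\xi$ denotes the composition of operators ($D_\xi$ is applied first). *)

theory Defs
  imports "HOL-Analysis.Analysis" "Jordan_Normal_Form.Matrix"
begin

text \<open>
  The size \<open>r\<close> of the vectors and matrices is a variable of the statement, so they are the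
  carrier-based ones of \<^theory>\<open>Jordan_Normal_Form.Matrix\<close>, not those of
  \<^theory>\<open>HOL-Analysis.Finite_Cartesian_Product\<close>. In particular \<open>\<bullet>\<close> is the scalar product there.
\<close>

no_notation inner (infix "\<bullet>" 70)

text \<open>The terminating series \<open>2F2(-n, 1; q, r; x)\<close>.\<close>

definition hyperLaguerre :: "real \<Rightarrow> real \<Rightarrow> nat \<Rightarrow> real \<Rightarrow> real" where
  "hyperLaguerre q r n x =
     (\<Sum>k=0..n. pochhammer (- real n) k * pochhammer 1 k
                 / (pochhammer q k * pochhammer r k) * (x ^ k / fact k))"

definition dcoeff :: "nat \<Rightarrow> nat \<Rightarrow> real \<Rightarrow> real" where
  "dcoeff r k x = (fact (r - 1) / fact k)\<^sup>2 * (1 / fact (r - 1 - k)) * x ^ k"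

text \<open>Vectors have \<open>r = \<xi> + 1\<close> entries, indexed by \<open>0, \<dots>, \<xi>\<close>.\<close>

definition dvec :: "nat \<Rightarrow> real \<Rightarrow> real Matrix.vec" where
  "dvec r x = Matrix.vec r (\<lambda>k. dcoeff r k x)"

text \<open>Column times row: the \<open>r \<times> r\<close> matrix with entries \<open>d\<^sub>i(x) d\<^sub>j(x)\<close>.\<close>

definition Mmat :: "nat \<Rightarrow> real \<Rightarrow> real Matrix.mat" where
  "Mmat r x = mat_of_cols r [dvec r x] * mat_of_rows r [dvec r x]"

definition jet :: "nat \<Rightarrow> (real \<Rightarrow> real) \<Rightarrow> real \<Rightarrow> real Matrix.vec" where
  "jet r y x = Matrix.vec r (\<lambda>k. (deriv ^^ k) y x)"

text \<open>
  The operators \<open>D\<^sub>\<xi>\<close> (with \<open>\<xi> = r - 1\<close>) and \<open>L\<^sub>2\<close>. Since \<^const>\<open>deriv\<close> is total, they are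
  meaningful only on sufficiently differentiable functions; they are applied to polynomials.
\<close>

definition D_op :: "nat \<Rightarrow> (real \<Rightarrow> real) \<Rightarrow> real \<Rightarrow> real" where
  "D_op r y t = (\<Sum>k=0..r - 1. dcoeff r k t * (deriv ^^ k) y t)"

definition L2_op :: "real \<Rightarrow> (real \<Rightarrow> real) \<Rightarrow> real \<Rightarrow> real" where
  "L2_op q y t = t * (deriv ^^ 2) y t + (q - t) * deriv y t"

end

theory Submission
  imports Defs
begin

text \<open>
  The matrix \<open>M(x)\<close> has rank one, so the integrand is \<open>D\<^sub>\<xi> y\<^sub>n(x) \<cdot> D\<^sub>\<xi> y\<^sub>m(x)\<close> times the weight
  (\<open>jet_Mmat_jet\<close>), and everything depends on what \<open>D\<^sub>\<xi>\<close> does to \<open>y\<^sub>n\<close>. The operator is diagonal on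
  monomials: each term \<open>d\<^sub>k(x) (d/dx)\<^sup>k\<close> preserves the degree, and the weights in \<open>d\<^sub>k\<close> are such
  that Vandermonde's convolution sums the eigenvalues to
  \<open>D\<^sub>\<xi> x\<^sup>j = (r - 1)! \<cdot> (r)\<^sub>j / j! \<cdot> x\<^sup>j\<close> (\<open>coeff_D_poly\<close>, \<open>choose_eq_pochhammer\<close>). The factor
  \<open>(r)\<^sub>j / (1)\<^sub>j\<close> cancels exactly the parameters \<open>1\<close> and \<open>r\<close> of the series \<open>2F2(-n, 1; q, r; x)\<close>, so
  \<open>D\<^sub>\<xi> y\<^sub>n = (r - 1)! \<cdot> 1F1(-n; q; x)\<close> (\<open>D_op_hyperLaguerre\<close>). This is a multiple of the Laguerre
  polynomial with parameter \<open>q - 1\<close>, and the two claims are its classical properties.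

  The differential equation is a two-term recurrence between consecutive coefficients
  (\<open>confluent_poly_ode\<close>). For orthogonality (\<open>confluent_poly_orthogonal\<close>), integrating \<open>1F1(-n; q; x)\<close>
  against \<open>x\<^sup>j\<close> term by term, with Euler's integral for the Gamma function, gives the alternating sum
  \<open>\<Gamma>(q) \<Sum>\<^sub>k (-1)\<^sup>k (n choose k) (q + k)\<^sub>j\<close>. It is an \<open>n\<close>-th finite difference of a monic polynomial of
  degree \<open>j\<close> in \<open>k\<close>, so it vanishes for \<open>j < n\<close> and is known for \<open>j = n\<close>
  (\<open>alternating_sum_pochhammer\<close>).
\<close>

section \<open>The operator \<open>D\<^sub>\<xi>\<close> on polynomials\<close>

lemma higher_deriv_poly:
  "(deriv ^^ k) (poly p) = poly ((pderiv ^^ k) p)" for p :: "real poly"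
proof (induction k)
  case (Suc k)
  have "deriv (poly s) = poly (pderiv s)" for s :: "real poly"
    by (rule ext, rule DERIV_imp_deriv) simp
  then show ?case using Suc by simp
qed simp

lemma pochhammer_Suc_diff_eq_choose:
  assumes "k \<le> j"
  shows "pochhammer (of_nat (Suc (j - k)) :: real) k = fact k * of_nat (j choose k)"
proof -
  have shift: "real j - real k + 1 = real (Suc (j - k))"
    using assms by simp
  have "real (j choose k) = pochhammer (real j - real k + 1) k / fact k"
    unfolding binomial_gbinomial by (rule gbinomial_pochhammer')
  then show ?thesis unfolding shift by (simp only: field_simps) simp
qed

text \<open>
  On polynomials \<open>D\<^sub>\<xi>\<close> is carried out on coefficients; the constant in \<open>d\<^sub>k\<close> is its value at \<open>1\<close>,
  since \<open>d\<^sub>k(x) = d\<^sub>k(1) x\<^sup>k\<close>.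
\<close>

definition D_poly :: "nat \<Rightarrow> real poly \<Rightarrow> real poly" where
  "D_poly r p = (\<Sum>k=0..r - 1. monom (dcoeff r k 1) k * (pderiv ^^ k) p)"

lemma D_op_poly: "D_op r (poly p) = poly (D_poly r p)"
  by (auto simp: D_op_def D_poly_def dcoeff_def higher_deriv_poly poly_sum poly_monom mult_ac
      intro!: sum.cong)

lemma dcoeff_one_eq_choose:
  assumes "k \<le> r - 1"
  shows "dcoeff r k 1 * fact k = fact (r - 1) * real ((r - 1) choose (r - 1 - k))"
proof -
  have "real ((r - 1) choose (r - 1 - k)) = fact (r - 1) / (fact k * fact (r - 1 - k))"
    unfolding binomial_symmetric[OF assms, symmetric] by (rule binomial_fact[OF assms])
  then show ?thesis
    by (simp add: dcoeff_def power2_eq_square field_simps)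
qed

text \<open>
  On \<open>x\<^sup>j\<close> the \<open>k\<close>-th term of the operator acts as \<open>(r - 1)! (j choose k) ((r - 1) choose k)\<close>: one
  factor \<open>k!\<close> of \<open>d\<^sub>k\<close> turns the falling factorial from the derivative into a binomial coefficient, the
  other belongs to the second binomial coefficient. Reflecting the latter gives a Vandermonde
  convolution.
\<close>

lemma coeff_D_poly:
  "coeff (D_poly r p) j = fact (r - 1) * real ((r - 1 + j) choose (r - 1)) * coeff p j"
proof -
  have summand: "coeff (monom (dcoeff r k 1) k * (pderiv ^^ k) p) j
      = fact (r - 1) * (real (j choose k) * real ((r - 1) choose (r - 1 - k))) * coeff p j"
    if "k \<le> r - 1" for k
  proof (cases "k \<le> j")
    case True
    have "coeff (monom (dcoeff r k 1) k * (pderiv ^^ k) p) j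
        = (dcoeff r k 1 * fact k) * real (j choose k) * coeff p j"
      using True pochhammer_Suc_diff_eq_choose[OF True]
      by (simp add: coeff_monom_mult coeff_higher_pderiv)
    then show ?thesis
      unfolding dcoeff_one_eq_choose[OF that] by (simp add: mult_ac)
  next
    case False
    then show ?thesis by (simp add: coeff_monom_mult binomial_eq_0)
  qed
  have "coeff (D_poly r p) j
      = (\<Sum>k\<le>r - 1. fact (r - 1) * (real (j choose k) * real ((r - 1) choose (r - 1 - k))) * coeff p j)"
    unfolding D_poly_def coeff_sum atMost_atLeast0[symmetric] by (intro sum.cong) (simp_all add: summand)
  also have "\<dots> = fact (r - 1) * real (\<Sum>k\<le>r - 1. (j choose k) * ((r - 1) choose (r - 1 - k))) * coeff p j"
    by (simp add: sum_distrib_left sum_distrib_right)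
  also have "\<dots> = fact (r - 1) * real ((r - 1 + j) choose (r - 1)) * coeff p j"
    by (simp only: vandermonde add.commute)
  finally show ?thesis .
qed

lemma choose_eq_pochhammer:
  assumes "r > 0"
  shows "real ((r - 1 + j) choose (r - 1)) = pochhammer (real r) j / fact j"
proof -
  have split: "pochhammer (1::real) (r - 1 + j) = pochhammer 1 (r - 1) * pochhammer (1 + real (r - 1)) j"
    by (rule pochhammer_product')
  have "1 + real (r - 1) = real r" using assms by simp
  then have fact_split: "fact (r - 1 + j) = fact (r - 1) * pochhammer (real r) j"
    using split by (simp only: pochhammer_fact)
  have "real ((r - 1 + j) choose (r - 1)) = fact (r - 1 + j) / (fact (r - 1) * fact j)"
    using binomial_fact[of "r - 1" "r - 1 + j", where 'a = real] by simp
  then show ?thesis unfolding fact_split by simp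
qed

section \<open>The terminating series as polynomials\<close>

text \<open>
  The polynomial \<open>1F1(-n; q; x)\<close>, which is \<open>n! / (q)\<^sub>n\<close> times the Laguerre polynomial of degree \<open>n\<close>
  with parameter \<open>q - 1\<close>.
\<close>

definition confluent_poly :: "real \<Rightarrow> nat \<Rightarrow> real poly" where
  "confluent_poly q n = (\<Sum>k\<le>n. monom (pochhammer (- real n) k / (pochhammer q k * fact k)) k)"

text \<open>
  The formula covers \<open>k > n\<close> as well, because \<open>(-n)\<^sub>k\<close> vanishes there.
\<close>

lemma coeff_confluent_poly:
  "coeff (confluent_poly q n) k = pochhammer (- real n) k / (pochhammer q k * fact k)"
  by (auto simp: confluent_poly_def coeff_sum pochhammer_of_nat_eq_0_iff)

lemma poly_confluent_poly:
  "poly (confluent_poly q n) x = (\<Sum>k\<le>n. coeff (confluent_poly q n) k * x ^ k)"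
  unfolding coeff_confluent_poly by (simp add: confluent_poly_def poly_sum poly_monom)

text \<open>
  The polynomial \<open>2F2(-n, 1; q, r; x)\<close>, with \<open>(1)\<^sub>k\<close> cancelled against \<open>k!\<close>.
\<close>

definition hyperLaguerre_poly :: "real \<Rightarrow> real \<Rightarrow> nat \<Rightarrow> real poly" where
  "hyperLaguerre_poly q r n =
     (\<Sum>k\<le>n. monom (pochhammer (- real n) k / (pochhammer q k * pochhammer r k)) k)"

lemma hyperLaguerre_eq_poly: "hyperLaguerre q r n = poly (hyperLaguerre_poly q r n)"
  by (rule ext) (simp add: hyperLaguerre_def hyperLaguerre_poly_def poly_sum poly_monom
      pochhammer_fact[symmetric] atMost_atLeast0)

text \<open>
  The eigenvalue \<open>(r - 1)! (r)\<^sub>j / j!\<close> of \<open>D\<^sub>\<xi>\<close> on \<open>x\<^sup>j\<close> removes \<open>(r)\<^sub>j\<close> from the denominator of the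
  coefficient and puts \<open>j!\<close> in its place.
\<close>

lemma D_poly_hyperLaguerre:
  assumes "r > 0"
  shows "D_poly r (hyperLaguerre_poly q (real r) n) = Polynomial.smult (fact (r - 1)) (confluent_poly q n)"
proof (rule poly_eqI)
  fix j
  have "pochhammer (real r) j > 0"
    using assms by (intro pochhammer_pos) simp
  then show "coeff (D_poly r (hyperLaguerre_poly q (real r) n)) j
      = coeff (Polynomial.smult (fact (r - 1)) (confluent_poly q n)) j"
    using choose_eq_pochhammer[OF assms, of j]
    by (simp add: coeff_D_poly hyperLaguerre_poly_def confluent_poly_def coeff_sum)
qed

lemma D_op_hyperLaguerre:
  assumes "r > 0"
  shows "D_op r (hyperLaguerre q (real r) n) = (\<lambda>t. fact (r - 1) * poly (confluent_poly q n) t)"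
  unfolding hyperLaguerre_eq_poly D_op_poly D_poly_hyperLaguerre[OF assms] by (rule ext) simp

section \<open>The confluent equation\<close>

text \<open>
  Comparing coefficients of \<open>x\<^sup>j\<close>, the equation says
  \<open>(j + 1) (q + j) c\<^sub>j\<^sub>+\<^sub>1 = (j - n) c\<^sub>j\<close>, which is the ratio of consecutive terms of the series.
\<close>

lemma confluent_poly_ode:
  assumes "q > 0"
  shows "monom 1 1 * pderiv (pderiv (confluent_poly q n)) + [:q, -1:] * pderiv (confluent_poly q n)
    = Polynomial.smult (- real n) (confluent_poly q n)"
proof (rule poly_eqI)
  fix j
  let ?c = "coeff (confluent_poly q n)"
  have "?c (Suc j) = (real j - real n) * ?c j / ((real j + 1) * (q + real j))"
    by (simp add: coeff_confluent_poly pochhammer_rec' mult_ac add_ac)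
  moreover have "real j + 1 \<noteq> 0" and "q + real j \<noteq> 0" using assms by simp_all
  ultimately have "(real j + 1) * (q + real j) * ?c (Suc j) = (real j - real n) * ?c j"
    by simp
  then show "coeff (monom 1 1 * pderiv (pderiv (confluent_poly q n)) + [:q, -1:] * pderiv (confluent_poly q n)) j
    = coeff (Polynomial.smult (- real n) (confluent_poly q n)) j"
    by (cases j) (simp_all add: coeff_monom_mult coeff_pderiv algebra_simps)
qed

lemma L2_op_confluent_poly:
  assumes "q > 0"
  shows "L2_op q (\<lambda>t. c * poly (confluent_poly q n) t) t = - real n * (c * poly (confluent_poly q n) t)"
proof -
  let ?P = "confluent_poly q n"
  have "(\<lambda>t. c * poly ?P t) = poly (Polynomial.smult c ?P)" by (rule ext) simp
  then have "L2_op q (\<lambda>t. c * poly ?P t) t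
      = c * (t * poly (pderiv (pderiv ?P)) t + (q - t) * poly (pderiv ?P) t)"
    using higher_deriv_poly[of 1 "Polynomial.smult c ?P"] higher_deriv_poly[of 2 "Polynomial.smult c ?P"]
    by (simp add: L2_op_def numeral_2_eq_2 pderiv_smult algebra_simps)
  also have "t * poly (pderiv (pderiv ?P)) t + (q - t) * poly (pderiv ?P) t
      = poly (monom 1 1 * pderiv (pderiv ?P) + [:q, -1:] * pderiv ?P) t"
    by (simp add: poly_monom algebra_simps)
  also have "\<dots> = - real n * poly ?P t"
    unfolding confluent_poly_ode[OF assms] by simp
  finally show ?thesis by simp
qed

section \<open>Orthogonality for the gamma weight\<close>

text \<open>
  Euler's integral for \<open>\<Gamma>(q + k)\<close>. The nonnegative integral gives integrability and value together,
  and the origin, where \<open>0 powr a = 0\<close>, does not contribute.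
\<close>

lemma has_bochner_integral_gamma_moment:
  assumes "q > 0"
  shows "has_bochner_integral lborel
    (\<lambda>x. indicator {0<..} x * (x ^ k * x powr (q - 1) * exp (- x))) (Gamma (q + real k))"
proof (rule has_bochner_integral_nn_integral)
  let ?s = "q + real k"
  have s: "?s > 0" using assms by simp
  have "(\<integral>\<^sup>+x. ennreal (indicator {0<..} x * (x ^ k * x powr (q - 1) * exp (- x))) \<partial>lborel)
      = (\<integral>\<^sup>+x. ennreal (indicator {0..} x * x powr (?s - 1) / exp x) \<partial>lborel)"
  proof (rule nn_integral_cong)
    fix x :: real
    show "ennreal (indicator {0<..} x * (x ^ k * x powr (q - 1) * exp (- x)))
        = ennreal (indicator {0..} x * x powr (?s - 1) / exp x)"
    proof (cases "x > 0")
      case True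
      have "x powr (?s - 1) = x powr real k * x powr (q - 1)"
        by (simp add: powr_add[symmetric] algebra_simps)
      then show ?thesis using True
        by (simp add: powr_realpow exp_minus divide_inverse)
    next
      case False
      then show ?thesis by (auto simp: indicator_def)
    qed
  qed
  also have "\<dots> = ennreal (Gamma ?s)"
    using Gamma_conv_nn_integral_real[OF s] by simp
  finally show "(\<integral>\<^sup>+x. ennreal (indicator {0<..} x * (x ^ k * x powr (q - 1) * exp (- x))) \<partial>lborel)
      = ennreal (Gamma ?s)" .
  show "0 \<le> Gamma ?s" using Gamma_real_pos[OF s] by simp
qed (auto simp: indicator_def intro!: AE_I2)

text \<open>
  By Pascal's rule, an \<open>(n + 1)\<close>-st finite difference is the \<open>n\<close>-th finite difference of the first
  difference.
\<close>

lemma alternating_binomial_sum_Suc: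
  fixes f :: "nat \<Rightarrow> real"
  shows "(\<Sum>k\<le>Suc n. (-1) ^ k * real (Suc n choose k) * f k)
    = (\<Sum>k\<le>n. (-1) ^ k * real (n choose k) * (f k - f (Suc k)))"
proof -
  have "(\<Sum>k\<le>Suc n. (-1) ^ k * real (Suc n choose k) * f k)
      = f 0 + (\<Sum>k\<le>n. (-1) ^ Suc k * real (Suc n choose Suc k) * f (Suc k))"
    by (subst sum.atMost_Suc_shift) simp
  also have "\<dots> = f 0 + (\<Sum>k\<le>n. (-1) ^ Suc k * real (n choose Suc k) * f (Suc k))
      - (\<Sum>k\<le>n. (-1) ^ k * real (n choose k) * f (Suc k))"
    by (simp add: sum.distrib sum_subtractf sum_negf algebra_simps)
  also have "f 0 + (\<Sum>k\<le>n. (-1) ^ Suc k * real (n choose Suc k) * f (Suc k))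
      = (\<Sum>k\<le>Suc n. (-1) ^ k * real (n choose k) * f k)"
    by (subst sum.atMost_Suc_shift) simp
  also have "\<dots> = (\<Sum>k\<le>n. (-1) ^ k * real (n choose k) * f k)"
    by (simp add: binomial_eq_0)
  finally show ?thesis
    by (simp add: sum_subtractf algebra_simps)
qed

text \<open>
  The polynomial \<open>(q + k)\<^sub>j\<close> in \<open>k\<close> is adapted to differences: its first difference is again of this
  shape, with \<open>q + 1\<close> and \<open>j - 1\<close> in place of \<open>q\<close> and \<open>j\<close>, times \<open>-j\<close>. This drives an induction on
  \<open>n\<close> with \<open>q\<close> and \<open>j\<close> generalized.
\<close>

lemma alternating_sum_pochhammer:
  fixes q :: real
  assumes "j \<le> n"
  shows "(\<Sum>k\<le>n. (-1) ^ k * real (n choose k) * pochhammer (q + real k) j)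
    = (if j = n then (-1) ^ n * fact n else 0)"
  using assms
proof (induction n arbitrary: q j)
  case (Suc n)
  show ?case
  proof (cases j)
    case 0
    have "(\<Sum>k\<le>Suc n. (-1) ^ k * real (Suc n choose k) * pochhammer (q + real k) 0) = 0"
      unfolding alternating_binomial_sum_Suc by simp
    then show ?thesis using 0 by simp
  next
    case (Suc i)
    have difference: "pochhammer (q + real k) (Suc i) - pochhammer (q + real (Suc k)) (Suc i)
        = - real (Suc i) * pochhammer (q + 1 + real k) i" for k
      using pochhammer_rec[of "q + real k" i] pochhammer_rec'[of "q + 1 + real k" i]
      by (simp add: algebra_simps)
    have "(\<Sum>k\<le>Suc n. (-1) ^ k * real (Suc n choose k) * pochhammer (q + real k) (Suc i))
        = - real (Suc i) * (\<Sum>k\<le>n. (-1) ^ k * real (n choose k) * pochhammer (q + 1 + real k) i)"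
      unfolding alternating_binomial_sum_Suc difference sum_distrib_left
      by (intro sum.cong) (simp_all add: mult_ac)
    also have "\<dots> = - real (Suc i) * (if i = n then (-1) ^ n * fact n else 0)"
      using Suc.IH[of i "q + 1"] Suc.prems Suc by simp
    also have "\<dots> = (if Suc i = Suc n then (-1) ^ Suc n * fact (Suc n) else 0)"
      by (simp add: algebra_simps)
    finally show ?thesis unfolding Suc .
  qed
qed simp

lemma pochhammer_neg_eq_choose:
  assumes "k \<le> n"
  shows "pochhammer (- real n) k / fact k = (-1) ^ k * real (n choose k)"
  using assms by (simp add: binomial_gbinomial gbinomial_pochhammer)

lemma Gamma_plus_nat:
  fixes q :: real
  assumes "q > 0"
  shows "Gamma (q + real n) = Gamma q * pochhammer q n"
proof -
  have "q \<notin> \<int>\<^sub>\<le>\<^sub>0" using assms by (auto elim!: nonpos_Ints_cases)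
  then show ?thesis
    using Gamma_real_pos[OF assms] by (simp add: pochhammer_Gamma)
qed

text \<open>
  In \<open>\<Gamma>(q + k + j) = \<Gamma>(q) (q)\<^sub>k (q + k)\<^sub>j\<close> the factor \<open>(q)\<^sub>k\<close> cancels the denominator of the \<open>k\<close>-th
  coefficient, which leaves the alternating binomial sum.
\<close>

lemma confluent_poly_moment:
  assumes "q > 0" and "j \<le> n"
  shows "has_bochner_integral lborel
    (\<lambda>x. indicator {0<..} x * (poly (confluent_poly q n) x * x ^ j * x powr (q - 1) * exp (- x)))
    (if j = n then (-1) ^ n * fact n * Gamma q else 0)"
proof -
  let ?P = "confluent_poly q n"
  have "has_bochner_integral lborel
    (\<lambda>x. \<Sum>k\<le>n. coeff ?P k * (indicator {0<..} x * (x ^ (k + j) * x powr (q - 1) * exp (- x))))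
    (\<Sum>k\<le>n. coeff ?P k * Gamma (q + real (k + j)))"
    by (intro has_bochner_integral_sum has_bochner_integral_mult_right
        has_bochner_integral_gamma_moment assms)
  then have "has_bochner_integral lborel
    (\<lambda>x. indicator {0<..} x * (poly ?P x * x ^ j * x powr (q - 1) * exp (- x)))
    (\<Sum>k\<le>n. coeff ?P k * Gamma (q + real (k + j)))"
    by (simp add: poly_confluent_poly sum_distrib_left sum_distrib_right power_add mult_ac)
  also have "(\<Sum>k\<le>n. coeff ?P k * Gamma (q + real (k + j)))
      = (\<Sum>k\<le>n. Gamma q * ((-1) ^ k * real (n choose k) * pochhammer (q + real k) j))"
  proof (rule sum.cong)
    fix k assume "k \<in> {..n}"
    have "Gamma (q + real (k + j)) = Gamma q * (pochhammer q k * pochhammer (q + real k) j)"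
      by (simp only: Gamma_plus_nat[OF assms(1)] pochhammer_product')
    moreover have "coeff ?P k = (-1) ^ k * real (n choose k) / pochhammer q k"
      using pochhammer_neg_eq_choose[of k n] \<open>k \<in> {..n}\<close>
      by (simp add: coeff_confluent_poly mult.commute flip: divide_divide_eq_left)
    moreover have "pochhammer q k > 0" using assms(1) by (rule pochhammer_pos)
    ultimately show "coeff ?P k * Gamma (q + real (k + j))
        = Gamma q * ((-1) ^ k * real (n choose k) * pochhammer (q + real k) j)"
      by simp
  qed simp
  also have "\<dots> = (if j = n then (-1) ^ n * fact n * Gamma q else 0)"
    unfolding sum_distrib_left[symmetric] alternating_sum_pochhammer[OF assms(2)] by simp
  finally show ?thesis .
qed

text \<open>
  Expanding the factor of smaller degree into monomials, only its term of degree \<open>n\<close> can survive. It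
  exists only for \<open>m = n\<close>, and then its coefficient is \<open>(-1)\<^sup>n / (q)\<^sub>n\<close>.
\<close>

lemma confluent_poly_orthogonal_le:
  assumes "q > 0" and "m \<le> n"
  shows "has_bochner_integral lborel
    (\<lambda>x. indicator {0<..} x
       * (poly (confluent_poly q n) x * poly (confluent_poly q m) x * x powr (q - 1) * exp (- x)))
    (if n = m then fact n * Gamma q / pochhammer q n else 0)"
proof -
  let ?P = "confluent_poly q"
  have "has_bochner_integral lborel
    (\<lambda>x. \<Sum>j\<le>m. coeff (?P m) j * (indicator {0<..} x * (poly (?P n) x * x ^ j * x powr (q - 1) * exp (- x))))
    (\<Sum>j\<le>m. coeff (?P m) j * (if j = n then (-1) ^ n * fact n * Gamma q else 0))"
    using assms
    by (intro has_bochner_integral_sum has_bochner_integral_mult_right confluent_poly_moment) auto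
  moreover have "(\<Sum>j\<le>m. coeff (?P m) j * (if j = n then (-1) ^ n * fact n * Gamma q else 0))
      = (if n = m then fact n * Gamma q / pochhammer q n else 0)"
    using assms(2)
    by (auto simp: coeff_confluent_poly pochhammer_same if_distrib cong: if_cong)
  ultimately show ?thesis
    by (simp add: poly_confluent_poly[of q m] sum_distrib_left sum_distrib_right mult_ac)
qed

lemma confluent_poly_orthogonal:
  assumes "q > 0"
  shows "has_bochner_integral lborel
    (\<lambda>x. indicator {0<..} x
       * (poly (confluent_poly q n) x * poly (confluent_poly q m) x * x powr (q - 1) * exp (- x)))
    (if n = m then fact n * Gamma q / pochhammer q n else 0)"
proof (cases "m \<le> n")
  case True
  then show ?thesis by (rule confluent_poly_orthogonal_le[OF assms])
next
  case False
  then show ?thesis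
    using confluent_poly_orthogonal_le[OF assms, of n m] by (simp add: mult_ac)
qed

section \<open>Reduction of the matrix form\<close>

lemma dvec_scalar_prod_jet:
  assumes "r > 0"
  shows "dvec r x \<bullet> jet r f x = D_op r f x"
proof -
  have "{0..<r} = {0..r - 1}" using assms by auto
  then show ?thesis
    unfolding scalar_prod_def D_op_def dvec_def jet_def by (auto intro!: sum.cong)
qed

text \<open>
  Since \<open>M = d d\<^sup>T\<close>, the bilinear form \<open>u\<^sup>T M v\<close> is \<open>(d\<^sup>T u) (d\<^sup>T v)\<close>.
\<close>

lemma jet_Mmat_jet:
  assumes "r > 0"
  shows "jet r f x \<bullet> (Mmat r x *\<^sub>v jet r g x) = D_op r f x * D_op r g x"
proof -
  have entry: "(Mmat r x *\<^sub>v jet r g x) $ i = dvec r x $ i * (dvec r x \<bullet> jet r g x)" if "i < r" for i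
  proof -
    have "Mmat r x $$ (i, j) = dvec r x $ i * dvec r x $ j" if "j < r" for j
      using \<open>i < r\<close> that
      by (simp add: Mmat_def mat_of_cols_def mat_of_rows_def scalar_prod_def)
    then show ?thesis
      using that
      by (simp add: mult_mat_vec_def scalar_prod_def Mmat_def jet_def sum_distrib_left mult_ac)
  qed
  have dim: "dim_vec (Mmat r x *\<^sub>v jet r g x) = r"
    by (simp add: Mmat_def)
  have "jet r f x \<bullet> (Mmat r x *\<^sub>v jet r g x)
      = (\<Sum>i = 0..<r. dvec r x $ i * jet r f x $ i) * (dvec r x \<bullet> jet r g x)"
    unfolding scalar_prod_def[of "jet r f x"] sum_distrib_right
    using dim by (auto simp: entry simp del: index_mult_mat_vec dim_mult_mat_vec intro!: sum.cong)
  also have "(\<Sum>i = 0..<r. dvec r x $ i * jet r f x $ i) = dvec r x \<bullet> jet r f x"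
    by (simp add: scalar_prod_def jet_def)
  finally show ?thesis by (simp only: dvec_scalar_prod_jet[OF assms])
qed

lemma confluent_norm_eq_binomial:
  assumes "q > 0"
  shows "fact n * Gamma q / pochhammer q n
    = Gamma (q + real n) / (((real n + q - 1) gchoose n)\<^sup>2 * fact n)"
proof -
  have binomial: "(real n + q - 1) gchoose n = pochhammer q n / fact n"
    by (simp add: gbinomial_pochhammer')
  have "pochhammer q n > 0" using assms by (rule pochhammer_pos)
  then show ?thesis
    unfolding Gamma_plus_nat[OF assms] binomial by (simp add: field_simps power2_eq_square)
qed

theorem theorem1:
  fixes r :: nat and q :: real and y :: "nat \<Rightarrow> real \<Rightarrow> real" and A :: "nat \<Rightarrow> real"
  assumes "r > 1" and "q > 0"
    and "y = hyperLaguerre q (real r)"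
    and "A = (\<lambda>n. (fact (r - 1))\<^sup>2 * Gamma (q + real n)
                     / (((real n + q - 1) gchoose n)\<^sup>2 * fact n))"
  shows "(\<forall>n m.
            set_integrable lborel {0<..}
              (\<lambda>x. (jet r (y n) x \<bullet> (Mmat r x *\<^sub>v jet r (y m) x)) * x powr (q - 1) * exp (- x)) \<and>
            (LINT x:{0<..}|lborel.
                (jet r (y n) x \<bullet> (Mmat r x *\<^sub>v jet r (y m) x)) * x powr (q - 1) * exp (- x))
              = (if n = m then A n else 0)) \<and>
         (\<forall>n t. L2_op q (D_op r (y n)) t = - real n * D_op r (y n) t)"
proof -
  let ?P = "confluent_poly q"
  have r: "r > 0" using assms(1) by simp
  have D: "D_op r (y n) = (\<lambda>t. fact (r - 1) * poly (?P n) t)" for n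
    unfolding assms(3) by (rule D_op_hyperLaguerre[OF r])
  have integral: "has_bochner_integral lborel
      (\<lambda>x. indicator {0<..} x *\<^sub>R
        ((jet r (y n) x \<bullet> (Mmat r x *\<^sub>v jet r (y m) x)) * x powr (q - 1) * exp (- x)))
      (if n = m then A n else 0)" for n m
  proof -
    have "has_bochner_integral lborel
      (\<lambda>x. (fact (r - 1))\<^sup>2 * (indicator {0<..} x *
        (poly (?P n) x * poly (?P m) x * x powr (q - 1) * exp (- x))))
      ((fact (r - 1))\<^sup>2 * (if n = m then fact n * Gamma q / pochhammer q n else 0))"
      by (intro has_bochner_integral_mult_right confluent_poly_orthogonal assms(2))
    moreover have "(fact (r - 1))\<^sup>2 * (if n = m then fact n * Gamma q / pochhammer q n else 0)
        = (if n = m then A n else 0)"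
      by (simp add: assms(4) confluent_norm_eq_binomial[OF assms(2)])
    ultimately show ?thesis
      by (simp add: jet_Mmat_jet[OF r] D power2_eq_square mult_ac split del: if_split)
  qed
  have "L2_op q (D_op r (y n)) t = - real n * D_op r (y n) t" for n t
    unfolding D by (rule L2_op_confluent_poly[OF assms(2)])
  with integral show ?thesis
    unfolding set_integrable_def set_lebesgue_integral_def has_bochner_integral_iff by blast
qed

end
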